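(* Let $H$ be a real symmetric matrix indexed by a finite set $V$, let $a,b\in V$ be distinct, and suppose that $\operatorname{supp}_H(e_a)\cup\operatorname{supp}_H(e_b)\subseteq c\mathbb Z$ for some real $c>0$. Let $k\in\mathcal K(H;a,b)$ and put $K=H/c$. Choose $\eta_0\in\operatorname{supp}_{K^k}(e_a)$ and define \[ \delta_k=\gcd\{|\eta-\eta_0|:\eta\in\operatorname{supp}_{K^k}(e_a)\setminus\{\eta_0\}\}. \] Then the integer $\delta_k$ is independent of the choice of $\eta_0$, and the minimum positive transfer time from $a$ to $b$ under $H^k$ is \[ \frac{\pi}{c^k\delta_k}. \]
   Context: $\mathbb N^+=\{1,2,3,\ldots\}$. For a finite set $V$, $e_v$ denotes the standard basis vector indexed by $v\in V$. For a real symmetric matrix $H$ indexed by $V$ with spectral decomposition $H=\sum_{\lambda\in\operatorname{Spec}(H)}\lambda E_\lambda$ ($E_\lambda$ the orthogonal projection onto the $\lambda$-eigenspace), and a vector $x$, put $\operatorname{supp}_H(x)=\{\lambda\in\operatorname{Spec}(H):E_\lambda x\neq 0\}$. A real symmetric matrix $M$ has perfect state transfer (PST) from $a$ to $b$ at time $\tau>0$ if $\exp(-\mathrm i\tau M)e_a=\gamma e_b$ for some $\gamma\in\mathbb C$ with $|\gamma|=1$; such a $\tau$ is called a transfer time under $M$. $M$ has PST from $a$ to $b$ if this holds for some $\tau>0$. $\mathcal K(H;a,b)=\{k\in\mathbb N^+: H^k\text{ has PST from }a\text{ to }b\}$. *)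

theory Defs
  imports "HOL-Analysis.Analysis"
begin

(* The class operations * and ^ on the type 'a ^ 'n ^ 'n act entrywise, so the powers with
   respect to the matrix product ** have to be defined separately. *)
primrec matpow :: "'a::semiring_1 ^ 'n ^ 'n \<Rightarrow> nat \<Rightarrow> 'a ^ 'n ^ 'n" where
  "matpow A 0 = mat 1"
| "matpow A (Suc n) = A ** matpow A n"

definition mat_exp :: "complex ^ 'n ^ 'n \<Rightarrow> complex ^ 'n ^ 'n" where
  "mat_exp A = (\<Sum>n. (1 / fact n) *\<^sub>R matpow A n)"

lemma mat_exp_summable: "summable (\<lambda>n. (1 / fact n) *\<^sub>R matpow A n)"
  for A :: "complex ^ 'n ^ 'n"
proof -
  define M where "M = (\<Sum>i\<in>UNIV. \<Sum>j\<in>UNIV. norm (A $ i $ j))"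
  have M0: "M \<ge> 0" unfolding M_def by (intro sum_nonneg) auto
  have row: "(\<Sum>l\<in>UNIV. norm (A $ i $ l)) \<le> M" for i
    unfolding M_def by (rule member_le_sum) (auto intro: sum_nonneg)
  have entry: "norm (matpow A n $ i $ j) \<le> M ^ n" for n i j
  proof (induction n arbitrary: i)
    case 0
    show ?case by (simp add: mat_def)
  next
    case (Suc n)
    have "norm (matpow A (Suc n) $ i $ j) \<le> (\<Sum>l\<in>UNIV. norm (A $ i $ l) * norm (matpow A n $ l $ j))"
      by (simp add: matrix_matrix_mult_def norm_mult[symmetric] norm_sum)
    also have "\<dots> \<le> (\<Sum>l\<in>UNIV. norm (A $ i $ l) * M ^ n)"
      by (intro sum_mono mult_left_mono Suc.IH) auto
    also have "\<dots> \<le> M * M ^ n"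
      unfolding sum_distrib_right[symmetric] using row M0 by (intro mult_right_mono) auto
    finally show ?case by simp
  qed
  have bound: "norm (matpow A n) \<le> (real CARD('n))\<^sup>2 * M ^ n" for n
  proof -
    have "norm (matpow A n) \<le> (\<Sum>i\<in>UNIV. norm (matpow A n $ i))"
      by (simp add: norm_vec_def L2_set_le_sum)
    also have "\<dots> \<le> (\<Sum>i\<in>(UNIV::'n set). \<Sum>j\<in>(UNIV::'n set). norm (matpow A n $ i $ j))"
      by (intro sum_mono) (simp add: norm_vec_def[of "matpow A n $ _"] L2_set_le_sum)
    also have "\<dots> \<le> (\<Sum>i\<in>(UNIV::'n set). \<Sum>j\<in>(UNIV::'n set). M ^ n)"
      by (intro sum_mono entry)
    finally show ?thesis by (simp add: power2_eq_square mult.assoc)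
  qed
  have s: "summable (\<lambda>n. (real CARD('n))\<^sup>2 * (inverse (fact n) * M ^ n))"
    by (intro summable_mult summable_exp)
  show ?thesis
  proof (rule summable_comparison_test'[OF s])
    fix n :: nat
    have "norm ((1 / fact n) *\<^sub>R matpow A n) \<le> (1 / fact n) * ((real CARD('n))\<^sup>2 * M ^ n)"
      using bound[of n] by (simp add: divide_right_mono)
    then show "norm ((1 / fact n) *\<^sub>R matpow A n) \<le> (real CARD('n))\<^sup>2 * (inverse (fact n) * M ^ n)"
      by (simp add: field_simps)
  qed
qed

definition eigenspace :: "real ^ 'n ^ 'n \<Rightarrow> real \<Rightarrow> (real ^ 'n) set" where
  "eigenspace H \<theta> = {v. H *v v = \<theta> *\<^sub>R v}"

(* Only real eigenvalues are collected; for the symmetric matrices considered here this is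
   the whole spectrum. *)
definition Spec :: "real ^ 'n ^ 'n \<Rightarrow> real set" where
  "Spec H = {\<theta>. \<exists>v\<in>eigenspace H \<theta>. v \<noteq> 0}"

definition orth_proj :: "'a::euclidean_space set \<Rightarrow> 'a \<Rightarrow> 'a" where
  "orth_proj S x = (THE y. y \<in> S \<and> (\<forall>z\<in>S. orthogonal (x - y) z))"

lemma orth_proj_ex1:
  fixes S :: "'a::euclidean_space set"
  assumes S: "subspace S"
  shows "\<exists>!y. y \<in> S \<and> (\<forall>z\<in>S. orthogonal (x - y) z)"
proof -
  obtain y w where "y \<in> span S" "\<And>z. z \<in> span S \<Longrightarrow> orthogonal w z" "x = y + w"
    using orthogonal_subspace_decomp_exists[of S x] by metis
  then have y: "y \<in> S" "\<forall>z\<in>S. orthogonal (x - y) z"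
    using span_eq_iff[THEN iffD2, OF S] by auto
  show ?thesis
  proof (rule ex1I[of _ y])
    fix y' assume y': "y' \<in> S \<and> (\<forall>z\<in>S. orthogonal (x - y') z)"
    have "y - y' \<in> S" using y y' S by (simp add: subspace_diff)
    then have "(x - y') \<bullet> (y - y') = 0" "(x - y) \<bullet> (y - y') = 0"
      using y y' by (auto simp: orthogonal_def)
    then have "(y - y') \<bullet> (y - y') = 0" by (simp add: inner_diff_left)
    then show "y' = y" by simp
  qed (use y in auto)
qed

lemma subspace_eigenspace: "subspace (eigenspace H \<theta>)"
  by (auto simp: eigenspace_def subspace_def matrix_vector_right_distrib
      matrix_vector_mult_scaleR scaleR_right_distrib)

definition eigsupp :: "real ^ 'n ^ 'n \<Rightarrow> real ^ 'n \<Rightarrow> real set" where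
  "eigsupp H x = {\<theta> \<in> Spec H. orth_proj (eigenspace H \<theta>) x \<noteq> 0}"

definition transfer_time :: "real ^ 'n ^ 'n \<Rightarrow> 'n \<Rightarrow> 'n \<Rightarrow> real \<Rightarrow> bool" where
  "transfer_time M a b \<tau> \<longleftrightarrow> \<tau> > 0 \<and>
     (\<exists>\<gamma>::complex. norm \<gamma> = 1 \<and>
        mat_exp (map_matrix (\<lambda>r. - \<i> * of_real \<tau> * of_real r) M) *v axis a 1 = \<gamma> *s axis b 1)"

definition has_pst :: "real ^ 'n ^ 'n \<Rightarrow> 'n \<Rightarrow> 'n \<Rightarrow> bool" where
  "has_pst M a b \<longleftrightarrow> (\<exists>\<tau>. transfer_time M a b \<tau>)"

definition pst_powers :: "real ^ 'n ^ 'n \<Rightarrow> 'n \<Rightarrow> 'n \<Rightarrow> nat set" where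
  "pst_powers H a b = {k. k \<ge> 1 \<and> has_pst (matpow H k) a b}"

(* Library gcds of sets live in int (or nat), not in real: the set of real numbers
   |eta - eta0| is pulled back along real_of_int.  Nothing is lost when the support consists
   of integers, as it does for the k-th power of H / c whenever the support for H lies in c Z. *)
definition supp_gcd :: "real ^ 'n ^ 'n \<Rightarrow> 'n \<Rightarrow> real \<Rightarrow> int" where
  "supp_gcd M a \<eta>\<^sub>0 =
     Gcd {n. \<exists>\<eta> \<in> eigsupp M (axis a 1) - {\<eta>\<^sub>0}. of_int n = \<bar>\<eta> - \<eta>\<^sub>0\<bar>}"

end

theory Submission
  imports Defs
begin

text \<open>Transfer at time \<open>t\<close> forces the spectral components of the two basis vectors to agree up to signs,
  and these signs do not depend on \<open>t\<close>. Hence \<open>t\<close> is a transfer time iff every \<open>t * (\<theta> - \<eta>) / \<pi>\<close> with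
  \<open>\<theta>\<close> in the support is an integer whose parity is prescribed by the signs. For an integral support
  with difference gcd \<open>g\<close>, every transfer time is then an odd multiple of \<open>\<pi> / g\<close>, and passing from one
  odd multiple to another changes no parity.\<close>

section \<open>Spectral decomposition\<close>

text \<open>A maximiser \<open>v\<close> of the Rayleigh quotient over the unit sphere of
  \<open>W\<close> is an eigenvector: moving from \<open>v\<close> in the direction of the defect
  \<open>d = f v - \<mu> v\<close> would otherwise increase the quotient. The invariant subspace
  \<open>W\<close> is left general so that it can later be the orthogonal complement of all
  eigenspaces.\<close>

lemma self_adjoint_eigenvector:
  fixes f :: "'a::euclidean_space \<Rightarrow> 'a"
  assumes f: "linear f" and adj: "\<And>x y. f x \<bullet> y = x \<bullet> f y"
    and W: "subspace W" and inv: "\<And>x. x \<in> W \<Longrightarrow> f x \<in> W"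
    and w: "w \<in> W" "w \<noteq> 0"
  obtains v \<mu> where "v \<in> W" "v \<noteq> 0" "f v = \<mu> *\<^sub>R v"
proof -
  have comp: "compact (W \<inter> sphere 0 1)"
    using closed_subspace[OF W] by (simp add: closed_Int_compact)
  have ne: "W \<inter> sphere 0 1 \<noteq> {}"
  proof -
    have "(1 / norm w) *\<^sub>R w \<in> W \<inter> sphere 0 1"
      using w W by (simp add: subspace_scale)
    then show ?thesis by blast
  qed
  have "continuous_on (W \<inter> sphere 0 1) (\<lambda>x. f x \<bullet> x)"
    using f by (intro continuous_intros linear_continuous_on) (simp add: linear_conv_bounded_linear)
  from continuous_attains_sup[OF comp ne this]
  obtain v where v: "v \<in> W" "norm v = 1"
    and max: "\<And>y. y \<in> W \<Longrightarrow> norm y = 1 \<Longrightarrow> f y \<bullet> y \<le> f v \<bullet> v"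
    by auto
  define \<mu> where "\<mu> = f v \<bullet> v"
  \<comment> \<open>By homogeneity the bound on the unit sphere extends to all of
    \<open>W\<close>.\<close>
  have quad: "f y \<bullet> y \<le> \<mu> * (y \<bullet> y)" if "y \<in> W" for y
  proof (cases "y = 0")
    case True
    then show ?thesis by simp
  next
    case False
    let ?u = "(1 / norm y) *\<^sub>R y"
    have "f ?u \<bullet> ?u \<le> \<mu>"
      unfolding \<mu>_def using that W False by (intro max) (auto simp: subspace_scale)
    moreover have "f ?u = (1 / norm y) *\<^sub>R f y" by (rule linear_scale[OF f])
    then have "f ?u \<bullet> ?u = (f y \<bullet> y) / (y \<bullet> y)"
      by (simp only: inner_scaleR_left inner_scaleR_right) (simp add: dot_square_norm power2_eq_square)
    ultimately have "(f y \<bullet> y) / (y \<bullet> y) \<le> \<mu>" by simp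
    moreover have "y \<bullet> y > 0" using False by simp
    ultimately show ?thesis by (simp only: pos_divide_le_eq)
  qed
  define d where "d = f v - \<mu> *\<^sub>R v"
  have dW: "d \<in> W" unfolding d_def using inv v W by (simp add: subspace_diff subspace_scale)
  define B where "B = \<mu> * (d \<bullet> d) - f d \<bullet> d"
  \<comment> \<open>Second-order expansion of the gap in \<open>quad\<close> at
    \<open>v + \<epsilon> d\<close>: the constant term is zero by the choice of
    \<open>\<mu>\<close>, and the linear coefficient is \<open>-2 (d \<bullet> d)\<close> by the
    choice of \<open>d\<close>.\<close>
  have "0 \<le> \<epsilon>\<^sup>2 * B - 2 * \<epsilon> * (d \<bullet> d)" for \<epsilon>
  proof -
    have "v + \<epsilon> *\<^sub>R d \<in> W" using v dW W by (simp add: subspace_add subspace_scale)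
    from quad[OF this]
    have "0 \<le> \<mu> * ((v + \<epsilon> *\<^sub>R d) \<bullet> (v + \<epsilon> *\<^sub>R d)) - f (v + \<epsilon> *\<^sub>R d) \<bullet> (v + \<epsilon> *\<^sub>R d)"
      by simp
    also have "f (v + \<epsilon> *\<^sub>R d) = f v + \<epsilon> *\<^sub>R f d"
      using f by (simp add: linear_add linear_scale)
    also have "\<mu> * ((v + \<epsilon> *\<^sub>R d) \<bullet> (v + \<epsilon> *\<^sub>R d)) - (f v + \<epsilon> *\<^sub>R f d) \<bullet> (v + \<epsilon> *\<^sub>R d)
      = \<mu> * (v \<bullet> v) - f v \<bullet> v + 2 * \<epsilon> * (\<mu> * (v \<bullet> d) - f v \<bullet> d) + \<epsilon>\<^sup>2 * B"
      unfolding B_def using adj[of d v]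
      by (simp add: inner_add_left inner_add_right inner_commute algebra_simps power2_eq_square)
    also have "v \<bullet> v = 1" using v by (simp add: norm_eq_1)
    also have "\<mu> * (v \<bullet> d) - f v \<bullet> d = - (d \<bullet> d)"
      unfolding d_def by (simp add: algebra_simps inner_diff_left)
    finally show ?thesis by (simp add: \<mu>_def)
  qed
  note pos = this
  have "d \<bullet> d = 0"
  proof (rule ccontr)
    assume "d \<bullet> d \<noteq> 0"
    then have p: "d \<bullet> d > 0" by simp
    \<comment> \<open>So small that the quadratic term cannot make up for the linear one; the added
      1 keeps the denominator positive when \<open>B = 0\<close>.\<close>
    define \<epsilon> where "\<epsilon> = (d \<bullet> d) / (\<bar>B\<bar> + 1)"
    have e: "\<epsilon> > 0" unfolding \<epsilon>_def using p by (intro divide_pos_pos) auto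
    have "0 \<le> \<epsilon> * (\<epsilon> * B - 2 * (d \<bullet> d))"
      using pos[of \<epsilon>] by (simp add: power2_eq_square algebra_simps)
    then have "2 * (d \<bullet> d) \<le> \<epsilon> * B" using e by (simp add: zero_le_mult_iff)
    also have "\<dots> \<le> \<epsilon> * (\<bar>B\<bar> + 1)" using e by (intro mult_left_mono) auto
    also have "\<dots> = d \<bullet> d" unfolding \<epsilon>_def by (simp add: add_nonneg_eq_0_iff)
    finally show False using p by simp
  qed
  then have "f v = \<mu> *\<^sub>R v" by (simp add: d_def)
  moreover have "v \<noteq> 0" using v by auto
  ultimately show thesis using v that by blast
qed

lemma orth_proj:
  fixes S :: "'a::euclidean_space set"
  assumes "subspace S"
  shows orth_proj_in: "orth_proj S x \<in> S"
    and orth_proj_inner: "z \<in> S \<Longrightarrow> orth_proj S x \<bullet> z = x \<bullet> z"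
proof -
  have *: "orth_proj S x \<in> S \<and> (\<forall>z\<in>S. orthogonal (x - orth_proj S x) z)"
    unfolding orth_proj_def by (rule theI'[OF orth_proj_ex1[OF assms]])
  then show "orth_proj S x \<in> S" by blast
  show "z \<in> S \<Longrightarrow> orth_proj S x \<bullet> z = x \<bullet> z"
    using * by (auto simp: orthogonal_def inner_diff_left)
qed

abbreviation eigproj :: "real ^ 'n ^ 'n \<Rightarrow> real \<Rightarrow> real ^ 'n \<Rightarrow> real ^ 'n" where
  "eigproj H \<theta> \<equiv> orth_proj (eigenspace H \<theta>)"

lemmas eigproj_in = orth_proj_in[OF subspace_eigenspace]
lemmas eigproj_inner = orth_proj_inner[OF subspace_eigenspace]

text \<open>Membership in the spectrum is automatic, since a nonzero projection is itself an
  eigenvector.\<close>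

lemma eigsupp_iff: "\<theta> \<in> eigsupp H x \<longleftrightarrow> eigproj H \<theta> x \<noteq> 0"
  using eigproj_in[of H \<theta> x] by (auto simp: eigsupp_def Spec_def)

lemma symmetric_adjoint:
  fixes H :: "real ^ 'n ^ 'n"
  assumes "transpose H = H"
  shows "(H *v x) \<bullet> y = x \<bullet> (H *v y)"
  by (metis assms dot_lmul_matrix transpose_matrix_vector)

lemma eigenspace_orthogonal:
  assumes "transpose H = H" "u \<in> eigenspace H \<theta>" "v \<in> eigenspace H \<mu>" "\<theta> \<noteq> \<mu>"
  shows "u \<bullet> v = 0"
  using symmetric_adjoint[OF assms(1), of u v] assms by (simp add: eigenspace_def)

text \<open>Choosing one eigenvector per eigenvalue gives an injective family of nonzero, pairwise
  orthogonal vectors, hence an independent set.\<close>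

lemma finite_Spec:
  fixes H :: "real ^ 'n ^ 'n"
  assumes H: "transpose H = H"
  shows "finite (Spec H)"
proof -
  have "\<forall>\<theta>\<in>Spec H. \<exists>v. v \<in> eigenspace H \<theta> \<and> v \<noteq> 0" by (auto simp: Spec_def)
  then obtain f where f: "\<And>\<theta>. \<theta> \<in> Spec H \<Longrightarrow> f \<theta> \<in> eigenspace H \<theta> \<and> f \<theta> \<noteq> 0"
    by metis
  have orth: "f x \<bullet> f y = 0" if "x \<in> Spec H" "y \<in> Spec H" "x \<noteq> y" for x y
    using eigenspace_orthogonal[OF H] f that by metis
  have "inj_on f (Spec H)"
    by (rule inj_onI) (metis f inner_eq_zero_iff orth)
  moreover have "finite (f ` Spec H)"
  proof -
    have "pairwise orthogonal (f ` Spec H)"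
      using orth by (fastforce simp: pairwise_def orthogonal_def)
    moreover have "0 \<notin> f ` Spec H" using f by auto
    ultimately show ?thesis
      using pairwise_orthogonal_independent independent_imp_finite by blast
  qed
  ultimately show ?thesis by (rule finite_imageD[rotated])
qed

text \<open>The residual \<open>w\<close> is orthogonal to every eigenspace. By symmetry the space
  \<open>W\<close> of all such vectors is invariant under \<open>H\<close>, so a nonzero
  \<open>w\<close> would yield an eigenvector in \<open>W\<close>, which would be orthogonal to
  itself.\<close>

lemma spectral_sum:
  fixes H :: "real ^ 'n ^ 'n"
  assumes H: "transpose H = H"
  shows "(\<Sum>\<theta>\<in>Spec H. eigproj H \<theta> x) = x"
proof (rule ccontr)
  define w where "w = x - (\<Sum>\<theta>\<in>Spec H. eigproj H \<theta> x)"
  define W where "W = {w. \<forall>\<theta>. \<forall>u\<in>eigenspace H \<theta>. w \<bullet> u = 0}"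
  assume "(\<Sum>\<theta>\<in>Spec H. eigproj H \<theta> x) \<noteq> x"
  then have "w \<noteq> 0" by (simp add: w_def)
  have "w \<bullet> u = 0" if u: "u \<in> eigenspace H \<mu>" for u \<mu>
  proof (cases "u = 0")
    case False
    then have mu: "\<mu> \<in> Spec H" using u by (auto simp: Spec_def)
    have "(\<Sum>\<theta>\<in>Spec H. eigproj H \<theta> x) \<bullet> u = (\<Sum>\<theta>\<in>Spec H. if \<theta> = \<mu> then x \<bullet> u else 0)"
      unfolding inner_sum_left
      by (intro sum.cong) (auto simp: eigproj_inner[OF u] eigenspace_orthogonal[OF H eigproj_in u])
    also have "\<dots> = x \<bullet> u" using mu finite_Spec[OF H] by simp
    finally show ?thesis by (simp add: w_def inner_diff_left)
  qed simp
  then have "w \<in> W" by (simp add: W_def)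
  have sub: "subspace W" by (auto simp: W_def subspace_def inner_add_left)
  have inv: "H *v y \<in> W" if "y \<in> W" for y
    using that symmetric_adjoint[OF H, of y] by (auto simp: W_def eigenspace_def)
  obtain v \<mu> where "v \<in> W" "v \<noteq> 0" "H *v v = \<mu> *\<^sub>R v"
    using self_adjoint_eigenvector[OF matrix_vector_mul_linear symmetric_adjoint[OF H] sub inv
        \<open>w \<in> W\<close> \<open>w \<noteq> 0\<close>] by metis
  then have "v \<bullet> v = 0" by (auto simp: W_def eigenspace_def)
  with \<open>v \<noteq> 0\<close> show False by simp
qed

text \<open>The inner product with \<open>y \<mu>\<close> removes every other summand. This allows
  equations between spectral sums to be compared one eigenvalue at a time.\<close>

lemma eigenspace_sum_eq_0:
  fixes y :: "real \<Rightarrow> real ^ 'n"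
  assumes H: "transpose H = H" and F: "finite F"
    and y: "\<And>\<theta>. \<theta> \<in> F \<Longrightarrow> y \<theta> \<in> eigenspace H \<theta>"
    and 0: "(\<Sum>\<theta>\<in>F. y \<theta>) = 0" and mu: "\<mu> \<in> F"
  shows "y \<mu> = 0"
proof -
  have "0 = (\<Sum>\<theta>\<in>F. y \<theta>) \<bullet> y \<mu>" using 0 by simp
  also have "\<dots> = (\<Sum>\<theta>\<in>F. if \<theta> = \<mu> then y \<mu> \<bullet> y \<mu> else 0)"
    unfolding inner_sum_left
    by (intro sum.cong) (auto simp: eigenspace_orthogonal[OF H y y[OF mu]])
  finally show ?thesis using F mu by simp
qed

section \<open>Matrix powers and exponentials\<close>

text \<open>\<open>matpow\<close> multiplies on the left while transposition reverses products;
  commutation reconciles the two.\<close>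

lemma matpow_commute: "matpow A n ** A = A ** matpow A n"
  by (induction n) (simp_all add: matrix_mul_assoc[symmetric])

lemma transpose_matpow:
  fixes A :: "'a::comm_semiring_1 ^ 'n ^ 'n"
  shows "transpose (matpow A n) = matpow (transpose A) n"
  by (induction n) (simp_all add: matrix_transpose_mul matpow_commute)

lemma matpow_scaleR:
  fixes A :: "real ^ 'n ^ 'n"
  shows "matpow (r *\<^sub>R A) n = r ^ n *\<^sub>R matpow A n"
  by (induction n) (simp_all add: scalar_matrix_assoc[symmetric] matrix_scalar_ac)

lemma matpow_eigenvector:
  fixes A :: "'a::comm_semiring_1 ^ 'n ^ 'n"
  assumes "A *v x = \<mu> *s x"
  shows "matpow A n *v x = \<mu> ^ n *s x"
proof (induction n)
  case (Suc n)
  have "A *v (\<mu> ^ n *s x) = \<mu> ^ n *s (A *v x)"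
    by (simp add: matrix_vector_mult_def vec_eq_iff sum_distrib_left mult.left_commute)
  then show ?case
    using assms Suc by (simp add: matrix_vector_mul_assoc[symmetric] mult.commute)
qed simp

lemma eigenspace_matpow:
  assumes "v \<in> eigenspace H \<theta>"
  shows "v \<in> eigenspace (matpow H k) (\<theta> ^ k)"
  using assms matpow_eigenvector[of H v \<theta> k]
  by (simp add: eigenspace_def scalar_mult_eq_scaleR)

lemma eigenspace_scaleR:
  assumes "v \<in> eigenspace H \<theta>"
  shows "v \<in> eigenspace (r *\<^sub>R H) (r * \<theta>)"
  using assms by (simp add: eigenspace_def scaleR_matrix_vector_assoc[symmetric])

text \<open>Evaluation at \<open>x\<close> is bounded linear in the matrix, so it passes through the
  exponential series, where each term acts as a power of \<open>\<mu>\<close>.\<close>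

lemma mat_exp_eigenvector:
  fixes A :: "complex ^ 'n ^ 'n"
  assumes "A *v x = \<mu> *s x"
  shows "mat_exp A *v x = exp \<mu> *s x"
proof -
  have "linear (\<lambda>B :: complex ^ 'n ^ 'n. B *v x)"
    by (rule linearI)
      (simp_all add: matrix_vector_mult_def vec_eq_iff sum.distrib distrib_right scaleR_sum_right)
  then have "bounded_linear (\<lambda>B :: complex ^ 'n ^ 'n. B *v x)"
    by (simp add: linear_conv_bounded_linear)
  then have "(\<lambda>n. ((1 / fact n) *\<^sub>R matpow A n) *v x) sums (mat_exp A *v x)"
    unfolding mat_exp_def by (rule bounded_linear.sums) (rule summable_sums[OF mat_exp_summable])
  moreover have "((1 / fact n) *\<^sub>R matpow A n) *v x = (\<mu> ^ n /\<^sub>R fact n) *s x" for n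
  proof -
    have "((1 / fact n) *\<^sub>R matpow A n) *v x = (1 / fact n) *\<^sub>R (matpow A n *v x)"
      by (simp add: matrix_vector_mult_def vec_eq_iff scaleR_sum_right)
    then show ?thesis
      by (simp add: matpow_eigenvector[OF assms] vec_eq_iff divide_inverse)
  qed
  moreover have "(\<lambda>n. (\<mu> ^ n /\<^sub>R fact n) *s x) sums (exp \<mu> *s x)"
  proof -
    have "linear (\<lambda>z :: complex. z *s x)"
      by (rule linearI) (simp_all add: vec_eq_iff distrib_right)
    then have "bounded_linear (\<lambda>z :: complex. z *s x)"
      by (simp add: linear_conv_bounded_linear)
    then show ?thesis by (rule bounded_linear.sums) (rule exp_converges)
  qed
  ultimately show ?thesis using sums_unique2 by auto
qed

section \<open>Transfer times in terms of eigenvalue phases\<close>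

text \<open>Eigenspaces and projections are real, whereas the exponential acts on complex vectors;
  this embedding links the two.\<close>

definition of_real_vec :: "real ^ 'n \<Rightarrow> complex ^ 'n" where
  "of_real_vec v = (\<chi> i. of_real (v $ i))"

lemma of_real_vec_sum: "of_real_vec (\<Sum>i\<in>F. f i) = (\<Sum>i\<in>F. of_real_vec (f i))"
  by (simp add: of_real_vec_def vec_eq_iff)

lemma of_real_vec_axis: "of_real_vec (axis a 1) = axis a 1"
  by (simp add: of_real_vec_def vec_eq_iff axis_def)

lemma mat_exp_of_real_vec:
  assumes "v \<in> eigenspace M \<theta>"
  shows "mat_exp (map_matrix (\<lambda>r. z * of_real r) M) *v of_real_vec v
    = exp (z * of_real \<theta>) *s of_real_vec v"
proof (rule mat_exp_eigenvector)
  have "(M *v v) $ i = \<theta> * v $ i" for i using assms by (simp add: eigenspace_def)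
  then have "complex_of_real (\<Sum>j\<in>UNIV. M $ i $ j * v $ j) = of_real (\<theta> * v $ i)" for i
    by (simp add: matrix_vector_mult_def)
  then show "map_matrix (\<lambda>r. z * of_real r) M *v of_real_vec v = (z * of_real \<theta>) *s of_real_vec v"
    by (simp add: vec_eq_iff matrix_vector_mult_def of_real_vec_def map_matrix_def mult.assoc
        sum_distrib_left[symmetric])
qed

lemma transfer_time_scaleR:
  assumes "r > 0"
  shows "transfer_time (r *\<^sub>R M) a b \<tau> \<longleftrightarrow> transfer_time M a b (r * \<tau>)"
proof -
  have "map_matrix (\<lambda>x. - \<i> * of_real \<tau> * of_real x) (r *\<^sub>R M)
      = map_matrix (\<lambda>x. - \<i> * of_real (r * \<tau>) * of_real x) M"
    by (simp add: vec_eq_iff map_matrix_def)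
  then show ?thesis using assms by (simp add: transfer_time_def zero_less_mult_iff)
qed

text \<open>Both basis vectors are expanded into spectral components. The exponential multiplies
  each component by a phase, and the components of a vector are unique.\<close>

lemma transfer_time_iff_eigproj:
  assumes M: "transpose M = M"
  shows "transfer_time M a b t \<longleftrightarrow> t > 0 \<and> (\<exists>\<gamma>::complex. norm \<gamma> = 1 \<and>
    (\<forall>\<theta>\<in>Spec M. exp (- \<i> * of_real t * of_real \<theta>) *s of_real_vec (eigproj M \<theta> (axis a 1))
      = \<gamma> *s of_real_vec (eigproj M \<theta> (axis b 1))))"
proof -
  let ?u = "\<lambda>\<theta>. eigproj M \<theta> (axis a 1)" and ?w = "\<lambda>\<theta>. eigproj M \<theta> (axis b 1)"
  let ?e = "\<lambda>\<theta>. exp (- \<i> * of_real t * of_real \<theta>)"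
  let ?U = "mat_exp (map_matrix (\<lambda>r. - \<i> * of_real t * of_real r) M)"
  have ax: "axis c 1 = (\<Sum>\<theta>\<in>Spec M. of_real_vec (eigproj M \<theta> (axis c 1)))" for c
    by (metis of_real_vec_sum spectral_sum[OF M] of_real_vec_axis)
  have U: "?U *v axis a 1 = (\<Sum>\<theta>\<in>Spec M. ?e \<theta> *s of_real_vec (?u \<theta>))"
    unfolding ax[of a] linear_sum[OF matrix_vector_mul_linear]
    by (intro sum.cong refl mat_exp_of_real_vec eigproj_in)
  have "(?U *v axis a 1 = \<gamma> *s axis b 1) \<longleftrightarrow>
    (\<forall>\<theta>\<in>Spec M. ?e \<theta> *s of_real_vec (?u \<theta>) = \<gamma> *s of_real_vec (?w \<theta>))" for \<gamma>
  proof -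
    have B: "\<gamma> *s axis b 1 = (\<Sum>\<theta>\<in>Spec M. \<gamma> *s of_real_vec (?w \<theta>))"
      by (subst ax) (simp add: vec_eq_iff sum_distrib_left)
    have "?e \<mu> *s of_real_vec (?u \<mu>) = \<gamma> *s of_real_vec (?w \<mu>)"
      if eq: "?U *v axis a 1 = \<gamma> *s axis b 1" and mu: "\<mu> \<in> Spec M" for \<mu>
    proof -
      have S: "(\<Sum>\<theta>\<in>Spec M. ?e \<theta> * of_real (?u \<theta> $ i)) = (\<Sum>\<theta>\<in>Spec M. \<gamma> * of_real (?w \<theta> $ i))" for i
        using eq unfolding U B by (simp add: vec_eq_iff of_real_vec_def)
      \<comment> \<open>The eigenspaces are real, so uniqueness of components is applied to the real
        and the imaginary parts separately.\<close>
      have "(\<Sum>\<theta>\<in>Spec M. Re (?e \<theta>) *\<^sub>R ?u \<theta> - Re \<gamma> *\<^sub>R ?w \<theta>) = 0"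
        using arg_cong[OF S, of Re] by (simp add: vec_eq_iff sum_subtractf)
      then have Re: "Re (?e \<mu>) *\<^sub>R ?u \<mu> - Re \<gamma> *\<^sub>R ?w \<mu> = 0"
        using eigenspace_sum_eq_0[OF M finite_Spec[OF M] _ _ mu,
            of "\<lambda>\<theta>. Re (?e \<theta>) *\<^sub>R ?u \<theta> - Re \<gamma> *\<^sub>R ?w \<theta>"]
        by (simp add: subspace_eigenspace subspace_diff subspace_scale eigproj_in)
      have "(\<Sum>\<theta>\<in>Spec M. Im (?e \<theta>) *\<^sub>R ?u \<theta> - Im \<gamma> *\<^sub>R ?w \<theta>) = 0"
        using arg_cong[OF S, of Im] by (simp add: vec_eq_iff sum_subtractf)
      then have Im: "Im (?e \<mu>) *\<^sub>R ?u \<mu> - Im \<gamma> *\<^sub>R ?w \<mu> = 0"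
        using eigenspace_sum_eq_0[OF M finite_Spec[OF M] _ _ mu,
            of "\<lambda>\<theta>. Im (?e \<theta>) *\<^sub>R ?u \<theta> - Im \<gamma> *\<^sub>R ?w \<theta>"]
        by (simp add: subspace_eigenspace subspace_diff subspace_scale eigproj_in)
      show ?thesis using Re Im by (simp add: vec_eq_iff of_real_vec_def complex_eq_iff)
    qed
    then show ?thesis unfolding U B by auto
  qed
  then show ?thesis unfolding transfer_time_def by blast
qed

text \<open>The phase relating the two projections has modulus 1 and maps a nonzero real vector to a
  real vector, so it is real and hence a sign. The conclusion does not mention \<open>t\<close>:
  signs found from one transfer time serve for all others.\<close>

lemma transfer_time_strongly_cospectral:
  assumes M: "transpose M = M" and t: "transfer_time M a b t"
  obtains s :: "real \<Rightarrow> real" where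
    "\<forall>\<theta>\<in>Spec M. s \<theta> = 1 \<or> s \<theta> = -1"
    "\<forall>\<theta>\<in>Spec M. eigproj M \<theta> (axis b 1) = s \<theta> *\<^sub>R eigproj M \<theta> (axis a 1)"
proof -
  let ?u = "\<lambda>\<theta>. eigproj M \<theta> (axis a 1)" and ?w = "\<lambda>\<theta>. eigproj M \<theta> (axis b 1)"
  let ?e = "\<lambda>\<theta>. exp (- \<i> * of_real t * of_real \<theta>)"
  from t obtain \<gamma> :: complex where g: "norm \<gamma> = 1"
    and eq: "\<And>\<theta>. \<theta> \<in> Spec M \<Longrightarrow> ?e \<theta> *s of_real_vec (?u \<theta>) = \<gamma> *s of_real_vec (?w \<theta>)"
    unfolding transfer_time_iff_eigproj[OF M] by blast
  have "\<exists>s::real. (s = 1 \<or> s = -1) \<and> ?w \<theta> = s *\<^sub>R ?u \<theta>" if th: "\<theta> \<in> Spec M" for \<theta>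
  proof -
    define \<rho> where "\<rho> = ?e \<theta> / \<gamma>"
    have "\<gamma> \<noteq> 0" using g by auto
    then have w: "of_real (?w \<theta> $ i) = \<rho> * of_real (?u \<theta> $ i)" for i
      using eq[OF th] by (simp add: \<rho>_def vec_eq_iff of_real_vec_def field_simps)
    have n: "norm \<rho> = 1" using g by (simp add: \<rho>_def norm_divide)
    show ?thesis
    proof (cases "?u \<theta> = 0")
      \<comment> \<open>Both projections vanish, so either sign will do.\<close>
      case True
      then have "?w \<theta> = 0" using w by (simp add: vec_eq_iff)
      then show ?thesis using True by auto
    next
      case False
      then obtain j where j: "?u \<theta> $ j \<noteq> 0" by (auto simp: vec_eq_iff)
      from arg_cong[OF w[of j], of Im] have "0 = Im \<rho> * ?u \<theta> $ j" by simp
      then have "Im \<rho> = 0" using j by simp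
      then have r: "\<rho> = of_real (Re \<rho>)" by (simp add: complex_eq_iff)
      then have "\<bar>Re \<rho>\<bar> = 1" using n by (metis norm_of_real)
      moreover have "?w \<theta> = Re \<rho> *\<^sub>R ?u \<theta>"
        using arg_cong[OF w, of Re] \<open>Im \<rho> = 0\<close> by (simp add: vec_eq_iff)
      ultimately show ?thesis by (intro exI[of _ "Re \<rho>"]) auto
    qed
  qed
  then show thesis using that by metis
qed

text \<open>The global phase \<open>\<gamma>\<close> is eliminated by normalising at the eigenvalue \<open>\<eta>\<close>.\<close>

lemma transfer_time_iff_parity:
  assumes M: "transpose M = M"
    and s: "\<forall>\<theta>\<in>Spec M. s \<theta> = 1 \<or> s \<theta> = (-1 :: real)"
    and cosp: "\<forall>\<theta>\<in>Spec M. eigproj M \<theta> (axis b 1) = s \<theta> *\<^sub>R eigproj M \<theta> (axis a 1)"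
    and eta: "\<eta> \<in> eigsupp M (axis a 1)"
  shows "transfer_time M a b t \<longleftrightarrow> t > 0 \<and> (\<forall>\<theta>\<in>eigsupp M (axis a 1).
    \<exists>m::int. t * (\<theta> - \<eta>) = of_int m * pi \<and> (even m \<longleftrightarrow> s \<theta> = s \<eta>))"
proof -
  let ?S = "eigsupp M (axis a 1)"
  let ?e = "\<lambda>\<theta>. exp (- \<i> * of_real t * of_real \<theta>)"
  have sub: "?S \<subseteq> Spec M" by (auto simp: eigsupp_def)
  \<comment> \<open>Off the support both projections vanish and the equation is void; on it a
    nonzero entry of the projection can be cancelled.\<close>
  have 1: "(\<forall>\<theta>\<in>Spec M. ?e \<theta> *s of_real_vec (eigproj M \<theta> (axis a 1))
      = \<gamma> *s of_real_vec (eigproj M \<theta> (axis b 1))) \<longleftrightarrow> (\<forall>\<theta>\<in>?S. ?e \<theta> = \<gamma> * of_real (s \<theta>))" for \<gamma>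
  proof -
    have "(?e \<theta> *s of_real_vec (eigproj M \<theta> (axis a 1)) = \<gamma> *s of_real_vec (eigproj M \<theta> (axis b 1)))
      \<longleftrightarrow> (\<theta> \<in> ?S \<longrightarrow> ?e \<theta> = \<gamma> * of_real (s \<theta>))" if "\<theta> \<in> Spec M" for \<theta>
      by (auto simp: cosp[rule_format, OF that] eigsupp_iff vec_eq_iff of_real_vec_def)
    then show ?thesis using sub by blast
  qed
  have 2: "?e \<theta> = ?e \<eta> * cis (- (t * (\<theta> - \<eta>)))" for \<theta>
    by (simp add: cis_conv_exp exp_add[symmetric] algebra_simps)
  have s2: "s \<theta> * s \<theta> = 1" if "\<theta> \<in> ?S" for \<theta>
  proof -
    have "s \<theta> = 1 \<or> s \<theta> = -1" using s that sub by blast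
    then show ?thesis by auto
  qed
  \<comment> \<open>The equation at \<open>\<eta>\<close> forces \<open>\<gamma>\<close> to be the
    phase at \<open>\<eta>\<close> times \<open>s \<eta>\<close>, because signs square to 1;
    conversely this value has modulus 1 and works.\<close>
  have 3: "(\<exists>\<gamma>::complex. norm \<gamma> = 1 \<and> (\<forall>\<theta>\<in>?S. ?e \<theta> = \<gamma> * of_real (s \<theta>))) \<longleftrightarrow>
    (\<forall>\<theta>\<in>?S. cis (- (t * (\<theta> - \<eta>))) = of_real (s \<eta> * s \<theta>))" (is "?L \<longleftrightarrow> ?R")
  proof
    assume ?L
    then obtain \<gamma> where g: "norm \<gamma> = 1" "\<And>\<theta>. \<theta> \<in> ?S \<Longrightarrow> ?e \<theta> = \<gamma> * of_real (s \<theta>)" by blast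
    have "?e \<eta> * of_real (s \<eta>) = \<gamma> * of_real (s \<eta> * s \<eta>)" using g(2)[OF eta] by simp
    then have gam: "\<gamma> = ?e \<eta> * of_real (s \<eta>)" using s2[OF eta] by simp
    show ?R
    proof
      fix \<theta> assume "\<theta> \<in> ?S"
      then have "?e \<eta> * cis (- (t * (\<theta> - \<eta>))) = ?e \<eta> * of_real (s \<eta> * s \<theta>)"
        using g(2)[of \<theta>] unfolding 2[of \<theta>] gam by (simp only: of_real_mult mult.assoc)
      then show "cis (- (t * (\<theta> - \<eta>))) = of_real (s \<eta> * s \<theta>)" by (subst (asm) mult_left_cancel) auto
    qed
  next
    assume R: ?R
    have "norm (?e \<eta> * of_real (s \<eta>)) = 1"
    proof -
      have "s \<eta> = 1 \<or> s \<eta> = -1" using s eta sub by blast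
      then have "\<bar>s \<eta>\<bar> = 1" by auto
      then show ?thesis by (simp add: norm_mult)
    qed
    moreover have "?e \<theta> = ?e \<eta> * of_real (s \<eta>) * of_real (s \<theta>)" if "\<theta> \<in> ?S" for \<theta>
    proof -
      have "cis (- (t * (\<theta> - \<eta>))) = of_real (s \<eta> * s \<theta>)" using R that by blast
      then show ?thesis unfolding 2[of \<theta>] by (simp only: of_real_mult mult.assoc)
    qed
    ultimately show ?L by blast
  qed
  \<comment> \<open>A real phase means that the sine vanishes, so the angle is
    \<open>m * pi\<close>; its cosine is then 1 or -1 according to the parity of
    \<open>m\<close>.\<close>
  have 4: "cis (- (t * (\<theta> - \<eta>))) = of_real (s \<eta> * s \<theta>) \<longleftrightarrow>
    (\<exists>m::int. t * (\<theta> - \<eta>) = of_int m * pi \<and> (even m \<longleftrightarrow> s \<theta> = s \<eta>))" if "\<theta> \<in> ?S" for \<theta>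
  proof -
    have ss: "s \<theta> = 1 \<or> s \<theta> = -1" "s \<eta> = 1 \<or> s \<eta> = -1" using s that eta sub by auto
    then have ev: "(if even m then 1 else -1) = s \<eta> * s \<theta> \<longleftrightarrow> (even m \<longleftrightarrow> s \<theta> = s \<eta>)" for m :: int
      by (elim disjE) simp_all
    have cs: "cos (of_int m * pi) = (if even m then 1 else -1)" for m :: int
      using cos_npi_int[of m] by (simp add: mult.commute)
    have "cis (- (t * (\<theta> - \<eta>))) = of_real (s \<eta> * s \<theta>) \<longleftrightarrow>
      cos (t * (\<theta> - \<eta>)) = s \<eta> * s \<theta> \<and> sin (t * (\<theta> - \<eta>)) = 0"
      by (simp add: complex_eq_iff)
    also have "\<dots> \<longleftrightarrow> (\<exists>m::int. t * (\<theta> - \<eta>) = of_int m * pi \<and> cos (of_int m * pi) = s \<eta> * s \<theta>)"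
      unfolding sin_zero_iff_int2 by metis
    finally show ?thesis unfolding cs ev .
  qed
  show ?thesis unfolding transfer_time_iff_eigproj[OF M] 1 3 using 4 by blast
qed

section \<open>Greatest common divisors of eigenvalue differences\<close>

text \<open>Bezout coefficients write the gcd as an integer combination, one element of
  \<open>D\<close> at a time. The empty set has gcd 0, which is why \<open>0 \<in> I\<close> is
  required.\<close>

lemma Gcd_int_in_subgroup:
  fixes I :: "int set"
  assumes "finite D" "D \<subseteq> I" "0 \<in> I"
    and lin: "\<And>x y u v. x \<in> I \<Longrightarrow> y \<in> I \<Longrightarrow> u * x + v * y \<in> I"
  shows "Gcd D \<in> I"
  using assms(1,2)
proof (induction D)
  case empty
  then show ?case using assms(3) by simp
next
  case (insert d D)
  obtain u v where "u * d + v * Gcd D = gcd d (Gcd D)" using bezout_int by blast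
  then show ?case using insert lin by (metis Gcd_insert insert_subset)
qed

text \<open>The gcd is defined from absolute values and leaves out \<open>\<eta>\<close> itself;
  this form covers signed differences, including \<open>d = 0\<close>.\<close>

lemma supp_gcd_dvd:
  assumes "\<theta> \<in> eigsupp M (axis a 1)" "\<theta> - \<eta> = of_int d"
  shows "supp_gcd M a \<eta> dvd d"
proof (cases "\<theta> = \<eta>")
  case False
  then have "supp_gcd M a \<eta> dvd \<bar>d\<bar>"
    unfolding supp_gcd_def using assms by (intro Gcd_dvd) (auto intro!: bexI[of _ \<theta>])
  then show ?thesis by simp
qed (use assms in simp)

text \<open>Each \<open>\<theta> - \<mu>\<close> is the difference of
  \<open>\<theta> - \<eta>\<close> and \<open>\<mu> - \<eta>\<close>, both divisible by the gcd
  based at \<open>\<eta>\<close>. Exchanging the base points gives equality.\<close>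

lemma supp_gcd_dvd_supp_gcd:
  assumes int: "eigsupp M (axis a 1) \<subseteq> \<int>"
    and eta: "\<eta> \<in> eigsupp M (axis a 1)" "\<mu> \<in> eigsupp M (axis a 1)"
  shows "supp_gcd M a \<eta> dvd supp_gcd M a \<mu>"
  unfolding supp_gcd_def[of M a \<mu>]
proof (rule Gcd_greatest)
  fix n assume "n \<in> {n. \<exists>\<theta>\<in>eigsupp M (axis a 1) - {\<mu>}. of_int n = \<bar>\<theta> - \<mu>\<bar>}"
  then obtain \<theta> where th: "\<theta> \<in> eigsupp M (axis a 1)" and n: "of_int n = \<bar>\<theta> - \<mu>\<bar>" by auto
  obtain x where x: "\<theta> - \<eta> = of_int x"
    using th eta int by (meson Ints_cases Ints_diff subsetD)
  obtain y where y: "\<mu> - \<eta> = of_int y"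
    using eta int by (meson Ints_cases Ints_diff subsetD)
  have "real_of_int n = \<bar>of_int (x - y)\<bar>" using n x y by (simp flip: x y)
  then have "n = \<bar>x - y\<bar>" by linarith
  moreover have "supp_gcd M a \<eta> dvd x - y"
    using supp_gcd_dvd[OF th x] supp_gcd_dvd[OF eta(2) y] by (rule dvd_diff)
  ultimately show "supp_gcd M a \<eta> dvd n" by simp
qed

lemma supp_gcd_unique:
  assumes "eigsupp M (axis a 1) \<subseteq> \<int>"
    and "\<eta> \<in> eigsupp M (axis a 1)" "\<mu> \<in> eigsupp M (axis a 1)"
  shows "supp_gcd M a \<eta> = supp_gcd M a \<mu>"
proof -
  have "supp_gcd M a \<nu> \<ge> 0" for \<nu> by (simp add: supp_gcd_def)
  then show ?thesis using supp_gcd_dvd_supp_gcd assms by (metis zdvd_antisym_nonneg)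
qed

text \<open>The multiples \<open>n\<close> for which \<open>t * n / \<pi>\<close> is an integer form an ideal containing all eigenvalue
  differences, hence also their gcd. The quotient \<open>t * gcd / \<pi>\<close> is odd, since otherwise all signs
  would agree and the two basis vectors would be parallel.\<close>

lemma transfer_time_supp_gcd:
  assumes M: "transpose M = M" and ab: "a \<noteq> b"
    and int: "eigsupp M (axis a 1) \<subseteq> \<int>"
    and eta: "\<eta> \<in> eigsupp M (axis a 1)"
    and s: "\<forall>\<theta>\<in>Spec M. s \<theta> = 1 \<or> s \<theta> = (-1 :: real)"
    and cosp: "\<forall>\<theta>\<in>Spec M. eigproj M \<theta> (axis b 1) = s \<theta> *\<^sub>R eigproj M \<theta> (axis a 1)"
    and t: "transfer_time M a b t"
  obtains m :: int where "odd m" "t * of_int (supp_gcd M a \<eta>) = of_int m * pi"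
proof -
  let ?S = "eigsupp M (axis a 1)"
  define D where "D = {n. \<exists>\<theta>\<in>?S - {\<eta>}. of_int n = \<bar>\<theta> - \<eta>\<bar>}"
  define I where "I = {n::int. \<exists>m::int. t * of_int n = of_int m * pi}"
  have par: "t > 0" "\<And>\<theta>. \<theta> \<in> ?S \<Longrightarrow> \<exists>m::int. t * (\<theta> - \<eta>) = of_int m * pi \<and> (even m \<longleftrightarrow> s \<theta> = s \<eta>)"
    using t unfolding transfer_time_iff_parity[OF M s cosp eta] by auto
  have "finite D"
  proof -
    have "finite ?S" using finite_Spec[OF M] by (simp add: eigsupp_def)
    moreover have "D \<subseteq> (\<lambda>\<theta>. \<lfloor>\<bar>\<theta> - \<eta>\<bar>\<rfloor>) ` ?S"
      unfolding D_def by (auto simp: image_iff) (metis floor_of_int)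
    ultimately show ?thesis using finite_surj by blast
  qed
  moreover have "D \<subseteq> I"
  proof
    fix n assume "n \<in> D"
    then obtain \<theta> where th: "\<theta> \<in> ?S" "of_int n = \<bar>\<theta> - \<eta>\<bar>" by (auto simp: D_def)
    with par obtain m :: int where m: "t * (\<theta> - \<eta>) = of_int m * pi" by blast
    have "t * of_int n = of_int m * pi \<or> t * of_int n = of_int (- m) * pi"
      using m th(2) by (auto simp: abs_if algebra_simps)
    then show "n \<in> I" unfolding I_def by blast
  qed
  moreover have "0 \<in> I" by (auto simp: I_def)
  moreover have "u * x + v * y \<in> I" if xy: "x \<in> I" "y \<in> I" for x y u v
  proof -
    obtain p q :: int where "t * of_int x = of_int p * pi" "t * of_int y = of_int q * pi"
      using xy by (auto simp: I_def)
    moreover have "t * of_int (u * x + v * y) = of_int u * (t * of_int x) + of_int v * (t * of_int y)"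
      by (simp add: algebra_simps)
    ultimately have "t * of_int (u * x + v * y) = of_int (u * p + v * q) * pi"
      by (simp add: algebra_simps)
    then show ?thesis unfolding I_def by blast
  qed
  ultimately have "Gcd D \<in> I" by (rule Gcd_int_in_subgroup)
  then obtain m :: int where m: "t * of_int (supp_gcd M a \<eta>) = of_int m * pi"
    by (auto simp: I_def D_def supp_gcd_def)
  have "odd m"
  proof
    assume "even m"
    \<comment> \<open>Every parity witness is a multiple of \<open>m\<close>: if
      \<open>\<theta> - \<eta>\<close> is \<open>e\<close> times the gcd, then
      \<open>n = m * e\<close>. An even \<open>m\<close> thus makes all of them even.\<close>
    have const: "s \<theta> = s \<eta>" if th: "\<theta> \<in> ?S" for \<theta>
    proof -
      obtain n :: int where n: "t * (\<theta> - \<eta>) = of_int n * pi" "even n \<longleftrightarrow> s \<theta> = s \<eta>"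
        using par th by blast
      obtain d where d: "\<theta> - \<eta> = of_int d"
        using th eta int by (meson Ints_cases Ints_diff subsetD)
      then obtain e where e: "d = supp_gcd M a \<eta> * e" using supp_gcd_dvd[OF th d] by (auto simp: dvd_def)
      have "of_int n * pi = of_int (m * e) * pi"
        using n(1) m unfolding d e by (simp add: mult.assoc[symmetric])
      then have "n = m * e" using pi_neq_zero by (metis mult_right_cancel of_int_eq_iff)
      then show ?thesis using n \<open>even m\<close> by simp
    qed
    \<comment> \<open>A common sign factors out of the spectral sum, making the two distinct basis
      vectors proportional.\<close>
    have "axis b 1 = (\<Sum>\<theta>\<in>Spec M. eigproj M \<theta> (axis b 1))" by (simp add: spectral_sum[OF M])
    also have "\<dots> = (\<Sum>\<theta>\<in>Spec M. s \<eta> *\<^sub>R eigproj M \<theta> (axis a 1))"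
      using cosp const by (intro sum.cong) (auto simp: eigsupp_iff)
    also have "\<dots> = s \<eta> *\<^sub>R axis a (1::real)"
      by (simp flip: scaleR_sum_right add: spectral_sum[OF M])
    finally have "(axis b 1 :: real ^ 'a) $ b = (s \<eta> *\<^sub>R axis a (1::real)) $ b" by simp
    then show False using ab by (simp add: axis_def)
  qed
  then show thesis using m that by blast
qed

text \<open>A given transfer time is \<open>m0 * pi / g\<close> with \<open>m0\<close> odd, where
  \<open>g\<close> is the gcd. Dividing by an odd number changes no parity, so \<open>pi / g\<close>
  meets the same sign conditions. Every transfer time is a positive odd multiple of
  \<open>pi / g\<close>, so none is smaller.\<close>

lemma min_transfer_time:
  assumes M: "transpose M = M" and ab: "a \<noteq> b"
    and int: "eigsupp M (axis a 1) \<subseteq> \<int>"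
    and eta: "\<eta> \<in> eigsupp M (axis a 1)"
    and pst: "has_pst M a b"
  shows "supp_gcd M a \<eta> > 0"
    and "transfer_time M a b (pi / of_int (supp_gcd M a \<eta>))"
    and "transfer_time M a b t \<Longrightarrow> pi / of_int (supp_gcd M a \<eta>) \<le> t"
proof -
  let ?S = "eigsupp M (axis a 1)" and ?g = "supp_gcd M a \<eta>"
  from pst obtain t0 where t0: "transfer_time M a b t0" by (auto simp: has_pst_def)
  obtain s :: "real \<Rightarrow> real" where s: "\<forall>\<theta>\<in>Spec M. s \<theta> = 1 \<or> s \<theta> = -1"
    and cosp: "\<forall>\<theta>\<in>Spec M. eigproj M \<theta> (axis b 1) = s \<theta> *\<^sub>R eigproj M \<theta> (axis a 1)"
    using transfer_time_strongly_cospectral[OF M t0] by metis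
  note parity = transfer_time_iff_parity[OF M s cosp eta]
  note gcd_odd = transfer_time_supp_gcd[OF M ab int eta s cosp]
  obtain m0 :: int where m0: "odd m0" "t0 * of_int ?g = of_int m0 * pi"
    using gcd_odd[OF t0] by blast
  \<comment> \<open>A zero gcd would give \<open>m0 * pi = 0\<close>, although \<open>m0\<close> is
    odd.\<close>
  have "?g \<noteq> 0" using m0 by auto
  moreover have "?g \<ge> 0" by (simp add: supp_gcd_def)
  ultimately show g: "?g > 0" by simp
  show "transfer_time M a b (pi / of_int ?g)"
    unfolding parity
  proof (intro conjI ballI)
    fix \<theta> assume th: "\<theta> \<in> ?S"
    obtain n :: int where n: "t0 * (\<theta> - \<eta>) = of_int n * pi" "even n \<longleftrightarrow> s \<theta> = s \<eta>"
      using t0 th unfolding parity by blast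
    obtain d where d: "\<theta> - \<eta> = of_int d"
      using th eta int by (meson Ints_cases Ints_diff subsetD)
    then obtain e where e: "d = ?g * e" using supp_gcd_dvd[OF th d] by (auto simp: dvd_def)
    have "of_int n * pi = of_int (m0 * e) * pi"
      using n(1) m0 unfolding d e by (simp add: mult.assoc[symmetric])
    then have "n = m0 * e" using pi_neq_zero by (metis mult_right_cancel of_int_eq_iff)
    \<comment> \<open>The parity of \<open>n = m0 * e\<close> is that of \<open>e\<close>, the
      witness for the shorter time.\<close>
    then have "even e \<longleftrightarrow> s \<theta> = s \<eta>" using n m0 by simp
    moreover have "pi / of_int ?g * (\<theta> - \<eta>) = of_int e * pi" unfolding d e using g by simp
    ultimately show "\<exists>m::int. pi / of_int ?g * (\<theta> - \<eta>) = of_int m * pi \<and> (even m \<longleftrightarrow> s \<theta> = s \<eta>)"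
      by blast
  qed (use g in simp)
  show "pi / of_int ?g \<le> t" if t: "transfer_time M a b t"
  proof -
    obtain m :: int where m: "odd m" "t * of_int ?g = of_int m * pi" using gcd_odd[OF t] by blast
    have "t > 0" using t by (simp add: transfer_time_def)
    then have "of_int m * pi > 0" using g m(2) by (metis mult_pos_pos of_int_0_less_iff)
    then have "m \<ge> 1" by (simp add: zero_less_mult_iff)
    then have "1 * pi \<le> of_int m * pi" by (intro mult_right_mono) auto
    then show ?thesis using g m(2) by (simp add: divide_le_eq)
  qed
qed

section \<open>Powers of the rescaled matrix and reduction to integral support\<close>

text \<open>Eigenvectors of \<open>H\<close> for \<open>\<theta>\<close> are eigenvectors of the
  power for \<open>(r * \<theta>) ^ k\<close>. If \<open>\<eta>\<close> is not such a value for any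
  \<open>\<theta>\<close> in the support, its eigenspace is orthogonal to all components of
  \<open>x\<close>, hence to \<open>x\<close>. Testing orthogonality avoids describing how
  eigenvalues with equal powers merge.\<close>

lemma eigsupp_matpow:
  assumes H: "transpose H = H"
  shows "eigsupp (matpow (r *\<^sub>R H) k) x \<subseteq> (\<lambda>\<theta>. (r * \<theta>) ^ k) ` eigsupp H x"
proof
  let ?N = "matpow (r *\<^sub>R H) k"
  fix \<eta> assume eta: "\<eta> \<in> eigsupp ?N x"
  have N: "transpose ?N = ?N" by (simp add: transpose_matpow transpose_scalar H)
  let ?u = "eigproj ?N \<eta> x"
  show "\<eta> \<in> (\<lambda>\<theta>. (r * \<theta>) ^ k) ` eigsupp H x"
  proof (rule ccontr)
    assume no: "\<eta> \<notin> (\<lambda>\<theta>. (r * \<theta>) ^ k) ` eigsupp H x"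
    have "?u \<bullet> ?u = (\<Sum>\<theta>\<in>Spec H. eigproj H \<theta> x) \<bullet> ?u"
      by (simp add: eigproj_inner eigproj_in spectral_sum[OF H])
    also have "\<dots> = (\<Sum>\<theta>\<in>Spec H. eigproj H \<theta> x \<bullet> ?u)" by (rule inner_sum_left)
    also have "\<dots> = 0"
    proof (rule sum.neutral, rule ballI)
      fix \<theta>
      show "eigproj H \<theta> x \<bullet> ?u = 0"
      proof (cases "\<theta> \<in> eigsupp H x")
        case True
        then have "(r * \<theta>) ^ k \<noteq> \<eta>" using no by blast
        then show ?thesis
          by (rule eigenspace_orthogonal[OF N eigenspace_matpow[OF eigenspace_scaleR[OF eigproj_in]]
                eigproj_in])
      qed (simp add: eigsupp_iff)
    qed
    finally show False using eta by (simp add: eigsupp_iff)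
  qed
qed

theorem corollary1p2:
  fixes H K :: "real ^ 'v ^ 'v" and a b :: "'v" and c \<eta>\<^sub>0 :: real and k :: nat
  assumes "transpose H = H"
    and "a \<noteq> b"
    and "c > 0"
    and "eigsupp H (axis a 1) \<union> eigsupp H (axis b 1) \<subseteq> {c * of_int z | z. True}"
    and "k \<in> pst_powers H a b"
    and "K = (1 / c) *\<^sub>R H"
    and "\<eta>\<^sub>0 \<in> eigsupp (matpow K k) (axis a 1)"
  shows "(\<forall>\<eta>\<^sub>1 \<in> eigsupp (matpow K k) (axis a 1).
            supp_gcd (matpow K k) a \<eta>\<^sub>1 = supp_gcd (matpow K k) a \<eta>\<^sub>0) \<and>
         transfer_time (matpow H k) a b (pi / (c ^ k * of_int (supp_gcd (matpow K k) a \<eta>\<^sub>0))) \<and>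
         (\<forall>\<tau>. transfer_time (matpow H k) a b \<tau> \<longrightarrow>
            pi / (c ^ k * of_int (supp_gcd (matpow K k) a \<eta>\<^sub>0)) \<le> \<tau>)"
proof -
  let ?N = "matpow K k" and ?g = "supp_gcd (matpow K k) a \<eta>\<^sub>0"
  have N: "transpose ?N = ?N" by (simp add: assms(1,6) transpose_matpow transpose_scalar)
  have "H = c *\<^sub>R K" using assms(3,6) by simp
  \<comment> \<open>Since \<open>matpow H k\<close> is \<open>c ^ k\<close> times
    \<open>matpow K k\<close>, the scalar can be absorbed into the time; this is the source of
    \<open>c ^ k\<close> in the denominator.\<close>
  then have time: "transfer_time (matpow H k) a b \<tau> \<longleftrightarrow> transfer_time ?N a b (c ^ k * \<tau>)" for \<tau>
    using assms(3) by (simp add: matpow_scaleR transfer_time_scaleR)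
  have int: "eigsupp ?N (axis a 1) \<subseteq> \<int>"
  proof
    fix \<eta> assume "\<eta> \<in> eigsupp ?N (axis a 1)"
    then obtain \<theta> where "\<theta> \<in> eigsupp H (axis a 1)" "\<eta> = (1 / c * \<theta>) ^ k"
      using eigsupp_matpow[OF assms(1), of "1 / c" k] assms(6) by blast
    moreover from this assms(4) obtain z :: int where "\<theta> = c * of_int z" by blast
    ultimately show "\<eta> \<in> \<int>" using assms(3) by simp
  qed
  have pst: "has_pst ?N a b" using assms(5) time by (auto simp: pst_powers_def has_pst_def)
  note min = min_transfer_time[OF N assms(2) int assms(7) pst]
  have "transfer_time (matpow H k) a b (pi / (c ^ k * of_int ?g))"
    using min(2) assms(3) unfolding time by simp
  moreover have "pi / (c ^ k * of_int ?g) \<le> \<tau>" if "transfer_time (matpow H k) a b \<tau>" for \<tau>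
    using min(1) min(3)[of "c ^ k * \<tau>"] that assms(3) unfolding time by (simp add: field_simps)
  ultimately show ?thesis using supp_gcd_unique[OF int _ assms(7)] by blast
qed

end
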